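(* Fix positive integers $n$ and $b$ with $b \mid n$, and fix $n\times n$ permutation matrices $P_L, P, P_R$. Let $\mathcal{GS}(P_L,P,P_R)$ denote the set of all $n\times n$ orthogonal matrices $A$ that can be written as $A = P_L\, L\, P\, R\, P_R$, where $L=\operatorname{diag}(L_1,\dots,L_{n/b})$ and $R=\operatorname{diag}(R_1,\dots,R_{n/b})$ are block-diagonal matrices with blocks $L_i,R_i\in\mathbb{R}^{b\times b}$. Then $\mathcal{GS}(P_L,P,P_R)$ is a smooth (embedded) submanifold of the orthogonal group $\mathrm{O}(n)$ (and of $\mathrm{GL}_n(\mathbb{R})$).
   Context: An $n\times n$ real matrix $A$ is orthogonal if $A^\top A=I$. It is a known fact (used freely) that every orthogonal matrix in $\mathcal{GS}(P_L,P,P_R)$ admits such a representation in which all diagonal blocks $L_i, R_i$ are themselves orthogonal, so $\mathcal{GS}(P_L,P,P_R)=\{P_L L P R P_R : L,R \text{ block-diagonal with } n/b \text{ orthogonal } b\times b \text{ blocks}\}$. *)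

theory Defs
  imports "HOL-Analysis.Analysis"
begin

fun higher_diff_on :: "nat \<Rightarrow> 'a::real_normed_vector set \<Rightarrow> ('a \<Rightarrow> 'b::real_normed_vector) \<Rightarrow> bool" where
  "higher_diff_on 0 S f = continuous_on S f"
| "higher_diff_on (Suc k) S f =
     ((\<forall>x\<in>S. f differentiable (at x)) \<and>
      (\<forall>v. higher_diff_on k S (\<lambda>x. frechet_derivative f (at x) v)))"

definition smooth_on :: "'a::real_normed_vector set \<Rightarrow> ('a \<Rightarrow> 'b::real_normed_vector) \<Rightarrow> bool" where
  "smooth_on S f \<longleftrightarrow> (\<forall>k. higher_diff_on k S f)"

definition smooth_embedded_submanifold :: "'a::euclidean_space set \<Rightarrow> nat \<Rightarrow> bool" where
  "smooth_embedded_submanifold M k \<longleftrightarrow>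
     (\<forall>p\<in>M. \<exists>U V (\<phi>::'a \<Rightarrow> 'a) \<psi> W.
        open U \<and> p \<in> U \<and> open V \<and> \<phi> ` U = V \<and>
        (\<forall>x\<in>U. \<psi> (\<phi> x) = x) \<and>
        smooth_on U \<phi> \<and> smooth_on V \<psi> \<and>
        subspace W \<and> dim W = k \<and> \<phi> ` (M \<inter> U) = V \<inter> W)"

definition permutation_matrix :: "real^'n^'n \<Rightarrow> bool" where
  "permutation_matrix P \<longleftrightarrow>
     (\<exists>\<sigma>. \<sigma> permutes (UNIV :: 'n set) \<and> P = (\<chi> i j. if \<sigma> i = j then 1 else 0))"

text \<open>Block-diagonal with consecutive b\<times>b blocks, w.r.t. the ordering of indices
  given by the bijection idx : 'n \<rightarrow> {0..<n}.\<close>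
definition block_diagonal :: "('n \<Rightarrow> nat) \<Rightarrow> nat \<Rightarrow> real^'n^'n \<Rightarrow> bool" where
  "block_diagonal idx b L \<longleftrightarrow>
     (\<forall>i j. idx i div b \<noteq> idx j div b \<longrightarrow> L $ i $ j = 0)"

definition GS :: "('n \<Rightarrow> nat) \<Rightarrow> nat \<Rightarrow> real^'n^'n \<Rightarrow> real^'n^'n \<Rightarrow> real^'n^'n \<Rightarrow> (real^'n^'n) set" where
  "GS idx b PL P PR = {A. orthogonal_matrix A \<and>
      (\<exists>L R. block_diagonal idx b L \<and> block_diagonal idx b R \<and> A = PL ** L ** P ** R ** PR)}"

end

theory Submission
  imports Defs
begin

text \<open>
  At \<open>p = PL L P R PR\<close> put \<open>p' = L P R\<close> and \<open>C = PL\<^sup>T X PR\<^sup>T p'\<^sup>T\<close>, so that \<open>X = p\<close> corresponds to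
  \<open>C = I\<close>. Membership of \<open>X\<close> in the set says that \<open>C\<close> is orthogonal and a product of an element of the
  algebra \<open>Z(E)\<close> of block-diagonal matrices and an element of the algebra \<open>Z(Q) = p' Z(E) p'\<^sup>T\<close>.
  The orthogonal projections onto the blocks and their conjugates by \<open>p'\<close> commute, because \<open>p'\<close> is
  monomial up to block-diagonal factors.

  With \<open>A\<close> the block-diagonal part of \<open>C\<close> and \<open>B = A\<^sup>T C\<close>, the quadratic map
  \<open>C \<mapsto> (C\<^sup>T C - I) + (A - A\<^sup>T) + (B - B\<^sup>T)\<close> has derivative \<open>2 id\<close> at \<open>I\<close>, hence is a local
  diffeomorphism. It straightens the set: for orthogonal \<open>C\<close> near \<open>I\<close>, the factorization exists iff
  \<open>A\<^sup>-\<^sup>1 C \<in> Z(Q)\<close> iff \<open>B \<in> Z(Q)\<close> iff \<open>B - B\<^sup>T \<in> Z(Q)\<close>. In the last step \<open>B B\<^sup>T\<close> equals the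
  block-diagonal part of \<open>B\<close>, and a solution of this equation near \<open>I\<close> is determined by its skew part, so it
  inherits the invariance of that part under the reflections \<open>I - 2 Q\<close>.

  Replacing \<open>p'\<close> by \<open>M p' N\<close> with block-diagonal \<open>M, N\<close> maps the tangent space by
  \<open>Y \<mapsto> M Y M\<^sup>T\<close>, so its dimension is constant. No orthogonality of the factors is needed.
\<close>

subsection \<open>Functions of class \<open>C\<^sup>k\<close> and the inverse function theorem\<close>

lemma higher_diff_on_mono_Suc: "higher_diff_on (Suc k) S f \<Longrightarrow> higher_diff_on k S f"
proof (induction k arbitrary: f)
  case 0
  then show ?case
    by (auto intro!: continuous_at_imp_continuous_on differentiable_imp_continuous_within)
next
  case (Suc k)
  then show ?case by (metis higher_diff_on.simps(2))
qed

lemma higher_diff_on_subset: "higher_diff_on k S f \<Longrightarrow> T \<subseteq> S \<Longrightarrow> higher_diff_on k T f"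
  by (induction k arbitrary: f) (auto intro: continuous_on_subset)

lemma higher_diff_on_cong:
  assumes "open S" "\<And>x. x \<in> S \<Longrightarrow> f x = g x"
  shows "higher_diff_on k S f = higher_diff_on k S g"
  using assms(2)
proof (induction k arbitrary: f g)
  case 0
  then show ?case by (auto intro!: continuous_on_cong)
next
  case (Suc k)
  have *: "(f has_derivative D) (at x) \<longleftrightarrow> (g has_derivative D) (at x)" if "x \<in> S" for x D
    using Suc.prems that assms(1) by (metis has_derivative_transform_within_open)
  have "frechet_derivative f (at x) = frechet_derivative g (at x)" if "x \<in> S" for x
    unfolding frechet_derivative_def using *[OF that] by simp
  then have "higher_diff_on k S (\<lambda>x. frechet_derivative f (at x) v)
      = higher_diff_on k S (\<lambda>x. frechet_derivative g (at x) v)" for v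
    by (intro Suc.IH) simp
  then show ?case using * by (auto simp: differentiable_def)
qed

text \<open>Derivatives are unique, so any explicit formula may stand in for
  \<open>frechet_derivative\<close>. Most inductions on the order below close their step this
  way.\<close>

lemma higher_diff_on_SucI:
  assumes "open S" "\<And>x. x \<in> S \<Longrightarrow> (f has_derivative f' x) (at x)"
    and "\<And>v. higher_diff_on k S (\<lambda>x. f' x v)"
  shows "higher_diff_on (Suc k) S f"
proof -
  have "frechet_derivative f (at x) = f' x" if "x \<in> S" for x
    using assms(2)[OF that] frechet_derivative_at by metis
  then have "higher_diff_on k S (\<lambda>x. frechet_derivative f (at x) v)" for v
    using assms(3) higher_diff_on_cong[OF assms(1), of "\<lambda>x. frechet_derivative f (at x) v" "\<lambda>x. f' x v"]
    by auto
  then show ?thesis using assms(2) by (auto simp: differentiable_def)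
qed

lemma higher_diff_on_SucD:
  assumes "higher_diff_on (Suc k) S f"
  shows "x \<in> S \<Longrightarrow> (f has_derivative frechet_derivative f (at x)) (at x)"
    and "higher_diff_on k S (\<lambda>x. frechet_derivative f (at x) v)"
  using assms by (auto simp: frechet_derivative_works)

lemma higher_diff_on_const [simp]: "higher_diff_on k S (\<lambda>x. c)"
  by (induction k arbitrary: c) auto

lemma higher_diff_on_add:
  assumes "open S" "higher_diff_on k S f" "higher_diff_on k S g"
  shows "higher_diff_on k S (\<lambda>x. f x + g x)"
  using assms(2,3)
proof (induction k arbitrary: f g)
  case 0
  then show ?case by (auto intro: continuous_intros)
next
  case (Suc k)
  note D = higher_diff_on_SucD[OF Suc.prems(1)] higher_diff_on_SucD[OF Suc.prems(2)]
  show ?case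
    by (rule higher_diff_on_SucI[OF assms(1) has_derivative_add[OF D(1,3)] Suc.IH[OF D(2,4)]])
qed

lemma higher_diff_on_sum:
  assumes "open S" "\<And>i. i \<in> I \<Longrightarrow> higher_diff_on k S (f i)"
  shows "higher_diff_on k S (\<lambda>x. \<Sum>i\<in>I. f i x)"
  using assms(2)
  by (induction I rule: infinite_finite_induct) (auto intro: higher_diff_on_add[OF assms(1)])

text \<open>Product rule: each summand of the derivative differentiates one factor only, so the
  other is lowered by one order before the induction hypothesis applies.\<close>

lemma higher_diff_on_bilinear:
  assumes "bounded_bilinear h" "open S" "higher_diff_on k S f" "higher_diff_on k S g"
  shows "higher_diff_on k S (\<lambda>x. h (f x) (g x))"
  using assms(3,4)
proof (induction k arbitrary: f g)
  case 0
  then show ?case using bounded_bilinear.continuous_on[OF assms(1)] by auto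
next
  case (Suc k)
  note mono = Suc.prems[THEN higher_diff_on_mono_Suc]
  note D = higher_diff_on_SucD[OF Suc.prems(1)] higher_diff_on_SucD[OF Suc.prems(2)]
  show ?case
    by (rule higher_diff_on_SucI[OF assms(2) bounded_bilinear.FDERIV[OF assms(1) D(1,3)]
      higher_diff_on_add[OF assms(2) Suc.IH[OF mono(1) D(4)] Suc.IH[OF D(2) mono(2)]]])
qed

lemma higher_diff_on_bounded_linear:
  assumes "bounded_linear h" "open S" "higher_diff_on k S f"
  shows "higher_diff_on k S (\<lambda>x. h (f x))"
  using assms(3)
proof (induction k arbitrary: f)
  case 0
  then show ?case using bounded_linear.continuous_on[OF assms(1)] by auto
next
  case (Suc k)
  note D = higher_diff_on_SucD[OF Suc.prems(1)]
  show ?case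
    by (rule higher_diff_on_SucI[OF assms(2) bounded_linear.has_derivative[OF assms(1) D(1)] Suc.IH[OF D(2)]])
qed

lemma higher_diff_on_diff:
  assumes "open S" "higher_diff_on k S f" "higher_diff_on k S g"
  shows "higher_diff_on k S (\<lambda>x. f x - g x)"
  using higher_diff_on_add[OF assms(1,2) higher_diff_on_bounded_linear
      [OF bounded_linear_minus[OF bounded_linear_ident] assms(1,3)]] by simp

lemma higher_diff_on_ident: "open S \<Longrightarrow> higher_diff_on k S (\<lambda>x. x)"
  by (cases k) (simp_all add: frechet_derivative_ident del: frechet_derivative_id)

text \<open>\<open>higher_diff_on\<close> differentiates in fixed directions. The expansion replaces
  a linear map applied to a moving vector by scalar functions times values at fixed basis
  vectors.\<close>

lemma linear_euclidean_expansion: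
  fixes v :: "'a::euclidean_space"
  assumes "linear h"
  shows "h v = (\<Sum>i\<in>Basis. (v \<bullet> i) *\<^sub>R h i)"
  by (subst euclidean_representation[symmetric])
    (simp add: linear_sum[OF assms] linear_cmul[OF assms])

lemma higher_diff_on_compose:
  fixes g :: "'a::real_normed_vector \<Rightarrow> 'b::euclidean_space"
  assumes "open S" "open T" "g ` S \<subseteq> T" "higher_diff_on k T f" "higher_diff_on k S g"
  shows "higher_diff_on k S (\<lambda>x. f (g x))"
  using assms(4,5)
proof (induction k arbitrary: f)
  case 0
  then show ?case using assms(3) by (auto intro: continuous_on_compose2)
next
  case (Suc k)
  let ?f' = "\<lambda>x. frechet_derivative f (at x)" and ?g' = "\<lambda>x. frechet_derivative g (at x)"
  have f': "(f has_derivative ?f' (g x)) (at (g x))" if "x \<in> S" for x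
    using higher_diff_on_SucD(1)[OF Suc.prems(1)] that assms(3) by blast
  have eq: "?f' (g x) (?g' x v) = (\<Sum>i\<in>Basis. (?g' x v \<bullet> i) *\<^sub>R ?f' (g x) i)" if "x \<in> S" for x v
    using f'[OF that] has_derivative_linear by (intro linear_euclidean_expansion)
  have "((\<lambda>x. f (g x)) has_derivative (\<lambda>v. \<Sum>i\<in>Basis. (?g' x v \<bullet> i) *\<^sub>R ?f' (g x) i)) (at x)"
    if "x \<in> S" for x
    using has_derivative_compose[OF higher_diff_on_SucD(1)[OF Suc.prems(2) that] f'[OF that]] eq[OF that]
    by simp
  then show ?case
  proof (rule higher_diff_on_SucI[OF assms(1)])
    show "higher_diff_on k S (\<lambda>x. \<Sum>i\<in>Basis. (?g' x v \<bullet> i) *\<^sub>R ?f' (g x) i)" for v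
      by (intro higher_diff_on_sum higher_diff_on_bilinear[OF bounded_bilinear_scaleR] assms(1)
          higher_diff_on_bounded_linear[OF bounded_linear_inner_left] Suc.IH
          higher_diff_on_SucD(2)[OF Suc.prems(1)] higher_diff_on_SucD(2)[OF Suc.prems(2)]
          higher_diff_on_mono_Suc[OF Suc.prems(2)])
  qed
qed

section \<open>Differentiating the inverse of a family of linear maps\<close>

text \<open>At a zero of \<open>r\<close> the product rule loses the term with the derivative of
  \<open>s\<close>. This makes inverses differentiable once they are known to be continuous.\<close>

lemma has_derivative_scaleR_vanishing:
  fixes r :: "'a::real_normed_vector \<Rightarrow> real" and s :: "'a \<Rightarrow> 'b::real_normed_vector"
  assumes r: "(r has_derivative R) (at x)" "r x = 0" and s: "isCont s x"
  shows "((\<lambda>z. r z *\<^sub>R s z) has_derivative (\<lambda>h. R h *\<^sub>R s x)) (at x)"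
proof -
  interpret R: bounded_linear R using r(1) by (rule has_derivative_bounded_linear)
  obtain K where K: "\<And>h. norm (R h) \<le> norm h * K" using R.bounded by blast
  define e where "e z = r z - r x - R (z - x)" for z
  have e: "((\<lambda>z. norm (e z) / norm (z - x)) \<longlongrightarrow> 0) (at x)"
    using r(1) by (simp add: has_derivative_iff_norm e_def)
  have lim_s: "((\<lambda>z. s z - s x) \<longlongrightarrow> 0) (at x)"
    using s by (auto simp: isCont_def LIM_zero_iff)
  have "((\<lambda>z. norm (e z) / norm (z - x) * norm (s z) + K * norm (s z - s x)) \<longlongrightarrow> 0 * norm (s x) + K * 0) (at x)"
    using s by (intro tendsto_add tendsto_mult tendsto_const tendsto_norm_zero tendsto_norm e lim_s) (simp add: isCont_def)
  then have lim: "((\<lambda>z. norm (e z) / norm (z - x) * norm (s z) + K * norm (s z - s x)) \<longlongrightarrow> 0) (at x)"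
    by simp
  have bound: "norm (r z *\<^sub>R s z - r x *\<^sub>R s x - R (z - x) *\<^sub>R s x) / norm (z - x)
      \<le> norm (e z) / norm (z - x) * norm (s z) + K * norm (s z - s x)" for z
  proof (cases "z = x")
    case False
    have "r z *\<^sub>R s z - r x *\<^sub>R s x - R (z - x) *\<^sub>R s x = e z *\<^sub>R s z + R (z - x) *\<^sub>R (s z - s x)"
      using r(2) by (simp add: e_def algebra_simps)
    then have "norm (r z *\<^sub>R s z - r x *\<^sub>R s x - R (z - x) *\<^sub>R s x)
        \<le> norm (e z) * norm (s z) + norm (R (z - x)) * norm (s z - s x)"
      by (metis norm_scaleR norm_triangle_ineq real_norm_def)
    also have "\<dots> \<le> norm (e z) * norm (s z) + (norm (z - x) * K) * norm (s z - s x)"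
      by (intro add_left_mono mult_right_mono K) auto
    finally show ?thesis using False by (simp add: field_simps)
  qed (simp add: R.zero)
  have "((\<lambda>z. norm (r z *\<^sub>R s z - r x *\<^sub>R s x - R (z - x) *\<^sub>R s x) / norm (z - x)) \<longlongrightarrow> 0) (at x)"
    by (rule Lim_null_comparison[OF always_eventually lim]) (use bound in simp)
  then show ?thesis
    using bounded_linear_compose[OF bounded_linear_scaleR_left R.bounded_linear]
    by (simp add: has_derivative_iff_norm)
qed

text \<open>\<open>T y0\<close> is bounded below by some \<open>c > 0\<close>, hence nearby
  \<open>T y\<close> by \<open>c / 2\<close>. So the two inverse values differ by at most 2/c times
  the residual \<open>v - T y (inv (T y0) v)\<close>, which tends to 0.\<close>

lemma continuous_on_inv_linear:
  fixes T :: "'b::topological_space \<Rightarrow> 'a::euclidean_space \<Rightarrow> 'a"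
  assumes lin: "\<And>y. y \<in> S \<Longrightarrow> linear (T y)" and bij: "\<And>y. y \<in> S \<Longrightarrow> bij (T y)"
    and cont: "\<And>w. continuous_on S (\<lambda>y. T y w)"
  shows "continuous_on S (\<lambda>y. inv (T y) v)"
  unfolding continuous_on_def
proof
  fix y0 assume y0: "y0 \<in> S"
  have T: "((\<lambda>y. T y w) \<longlongrightarrow> T y0 w) (at y0 within S)" for w
    using cont y0 by (auto simp: continuous_on_def)
  obtain c where c: "c > 0" "\<And>w. c * norm w \<le> norm (T y0 w)"
    using linear_inj_bounded_below_pos[OF lin[OF y0]] bij[OF y0] by (metis bij_is_inj mult.commute)
  let ?N = "\<lambda>y. \<Sum>i\<in>Basis. norm (T y i - T y0 i)" and ?u = "\<lambda>y. inv (T y) v"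
  have N: "norm (T y w - T y0 w) \<le> ?N y * norm w" if "y \<in> S" for y w
  proof -
    have "T y w - T y0 w = (\<Sum>i\<in>Basis. (w \<bullet> i) *\<^sub>R (T y i - T y0 i))"
      by (rule linear_euclidean_expansion[OF linear_compose_sub[OF lin[OF that] lin[OF y0]]])
    also have "norm \<dots> \<le> (\<Sum>i\<in>Basis. norm (T y i - T y0 i) * norm w)"
      by (intro sum_norm_le) (auto simp: mult.commute[of _ "norm w"] intro!: mult_right_mono Basis_le_norm)
    finally show ?thesis by (simp add: sum_distrib_right)
  qed
  have "(?N \<longlongrightarrow> (\<Sum>i\<in>Basis. norm (T y0 i - T y0 i))) (at y0 within S)"
    by (intro tendsto_intros T)
  then have ev: "\<forall>\<^sub>F y in at y0 within S. ?N y < c / 2"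
    using c(1) order_tendstoD(2)[of ?N 0 _ "c / 2"] by simp
  have "((\<lambda>y. norm (v - T y (?u y0)) * (2 / c)) \<longlongrightarrow> norm (v - T y0 (?u y0)) * (2 / c)) (at y0 within S)"
    by (intro tendsto_intros T)
  moreover have "T y0 (?u y0) = v" by (simp add: surj_f_inv_f bij_is_surj[OF bij[OF y0]])
  ultimately have lim: "((\<lambda>y. norm (v - T y (?u y0)) * (2 / c)) \<longlongrightarrow> 0) (at y0 within S)" by simp
  have est: "norm (?u y - ?u y0) \<le> norm (v - T y (?u y0)) * (2 / c)" if y: "?N y < c / 2" "y \<in> S" for y
  proof -
    let ?w = "?u y - ?u y0"
    have "c * norm ?w \<le> norm (T y0 ?w)" by (rule c)
    also have "\<dots> \<le> norm (T y ?w) + norm (T y ?w - T y0 ?w)" using norm_triangle_ineq4[of "T y ?w" "T y ?w - T y0 ?w"] by simp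
    also have "\<dots> \<le> norm (T y ?w) + c / 2 * norm ?w"
      using N[OF y(2), of ?w] y(1) by (smt (verit) mult_right_mono norm_ge_zero)
    finally have "c / 2 * norm ?w \<le> norm (T y ?w)" by simp
    moreover have "T y ?w = v - T y (?u y0)"
      using linear_diff[OF lin[OF y(2)], of "?u y" "?u y0"] surj_f_inv_f[OF bij_is_surj[OF bij[OF y(2)]], of v] by simp
    ultimately show ?thesis using c(1) by (simp add: field_simps)
  qed
  have "\<forall>\<^sub>F y in at y0 within S. y \<in> S" by (auto simp: eventually_at_filter)
  then have "\<forall>\<^sub>F y in at y0 within S. norm (?u y - ?u y0) \<le> norm (v - T y (?u y0)) * (2 / c)"
    by (rule eventually_elim2[OF ev]) (rule est)
  then have "((\<lambda>y. ?u y - ?u y0) \<longlongrightarrow> 0) (at y0 within S)"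
    using lim by (rule Lim_null_comparison)
  then show "(?u \<longlongrightarrow> ?u y0) (at y0 within S)" by (simp add: LIM_zero_iff)
qed

text \<open>This is the formula -T^-1 T' T^-1 v in coordinates. With u = \<open>inv (T y) v\<close>,
  the value \<open>inv (T z) v\<close> is u minus \<open>inv (T z)\<close> applied to the residual T
  z u - v. The residual vanishes at z = y, so the product rule at a zero applies to each
  coordinate.\<close>

lemma has_derivative_inv_linear:
  fixes T :: "'b::real_normed_vector \<Rightarrow> 'a::euclidean_space \<Rightarrow> 'a"
  assumes S: "open S" "y \<in> S"
    and lin: "\<And>z. z \<in> S \<Longrightarrow> linear (T z)" and bij: "\<And>z. z \<in> S \<Longrightarrow> bij (T z)"
    and cont: "\<And>w. continuous_on S (\<lambda>z. T z w)"
    and der: "\<And>w. ((\<lambda>z. T z w) has_derivative D w) (at y)"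
  shows "((\<lambda>z. inv (T z) v) has_derivative
    (\<lambda>h. - (\<Sum>i\<in>Basis. ((\<Sum>j\<in>Basis. (inv (T y) v \<bullet> j) *\<^sub>R D j h) \<bullet> i) *\<^sub>R inv (T y) i))) (at y)"
proof -
  let ?u = "inv (T y) v"
  define r where "r z = (\<Sum>j\<in>Basis. (?u \<bullet> j) *\<^sub>R T z j) - v" for z
  define R where "R h = (\<Sum>j\<in>Basis. (?u \<bullet> j) *\<^sub>R D j h)" for h
  have r: "r z = T z ?u - v" if "z \<in> S" for z
    unfolding r_def by (rule arg_cong[OF linear_euclidean_expansion[OF lin[OF that], symmetric]])
  have "(r has_derivative (\<lambda>h. R h - 0)) (at y)"
    unfolding r_def R_def by (intro has_derivative_diff has_derivative_sum has_derivative_scaleR_right der has_derivative_const)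
  then have r': "((\<lambda>z. r z \<bullet> i) has_derivative (\<lambda>h. R h \<bullet> i)) (at y)" for i
    using bounded_linear.has_derivative[OF bounded_linear_inner_left] by fastforce
  have r0: "r y = 0"
    by (simp add: r[OF S(2)] surj_f_inv_f bij_is_surj[OF bij[OF S(2)]])
  have cont_inv: "isCont (\<lambda>z. inv (T z) i) y" for i
    using continuous_on_inv_linear[of S T, OF lin bij cont] S by (simp add: continuous_on_eq_continuous_at)
  have *: "((\<lambda>z. ?u - (\<Sum>i\<in>Basis. (r z \<bullet> i) *\<^sub>R inv (T z) i)) has_derivative
      (\<lambda>h. 0 - (\<Sum>i\<in>Basis. (R h \<bullet> i) *\<^sub>R inv (T y) i))) (at y)"
    by (intro has_derivative_diff has_derivative_sum has_derivative_const
        has_derivative_scaleR_vanishing r' cont_inv) (simp add: r0)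
  have eq: "inv (T z) v = ?u - (\<Sum>i\<in>Basis. (r z \<bullet> i) *\<^sub>R inv (T z) i)" if z: "z \<in> S" for z
  proof -
    have lin_inv: "linear (inv (T z))"
      using lin[OF z] bij[OF z] by (simp add: bij_is_inj bij_is_surj inj_linear_imp_inv_linear)
    have "(\<Sum>i\<in>Basis. (r z \<bullet> i) *\<^sub>R inv (T z) i) = inv (T z) (r z)"
      by (rule linear_euclidean_expansion[OF lin_inv, symmetric])
    also have "\<dots> = ?u - inv (T z) v"
      by (simp add: r[OF z] linear_diff[OF lin_inv] inv_f_f bij_is_inj[OF bij[OF z]])
    finally show ?thesis by simp
  qed
  show ?thesis
    using has_derivative_transform_within_open[OF * S eq[symmetric]] by (simp add: R_def)
qed

text \<open>The derivative formula involves only derivatives of \<open>T\<close> and inverses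
  applied to fixed vectors, so the induction closes with \<open>v\<close> arbitrary.\<close>

lemma higher_diff_on_inv_linear:
  fixes T :: "'b::real_normed_vector \<Rightarrow> 'a::euclidean_space \<Rightarrow> 'a"
  assumes S: "open S"
    and lin: "\<And>y. y \<in> S \<Longrightarrow> linear (T y)" and bij: "\<And>y. y \<in> S \<Longrightarrow> bij (T y)"
    and diff: "\<And>w. higher_diff_on k S (\<lambda>y. T y w)"
  shows "higher_diff_on k S (\<lambda>y. inv (T y) v)"
  using diff
proof (induction k arbitrary: v)
  case 0
  then show ?case by (auto intro!: continuous_on_inv_linear lin bij)
next
  case (Suc k)
  have T: "higher_diff_on k S (\<lambda>y. T y w)" for w
    using Suc.prems by (rule higher_diff_on_mono_Suc)
  have cont: "continuous_on S (\<lambda>z. T z w)" for w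
    using higher_diff_on_SucD(1)[OF Suc.prems] has_derivative_continuous
    by (blast intro: continuous_at_imp_continuous_on)
  show ?case
  proof (rule higher_diff_on_SucI[OF S])
    show "higher_diff_on k S (\<lambda>y. - (\<Sum>i\<in>Basis. ((\<Sum>j\<in>Basis. (inv (T y) v \<bullet> j) *\<^sub>R
        frechet_derivative (\<lambda>z. T z j) (at y) h) \<bullet> i) *\<^sub>R inv (T y) i))" for h
      by (intro higher_diff_on_bounded_linear[OF bounded_linear_minus[OF bounded_linear_ident]]
          higher_diff_on_bounded_linear[OF bounded_linear_inner_left] S
          higher_diff_on_sum higher_diff_on_bilinear[OF bounded_bilinear_scaleR]
          Suc.IH[OF T] higher_diff_on_SucD(2)[OF Suc.prems])
  next
    fix y assume y: "y \<in> S"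
    have "((\<lambda>z. T z w) has_derivative frechet_derivative (\<lambda>z. T z w) (at y)) (at y)" for w
      by (rule higher_diff_on_SucD(1)[OF Suc.prems y])
    then show "((\<lambda>y. inv (T y) v) has_derivative (\<lambda>h. - (\<Sum>i\<in>Basis. ((\<Sum>j\<in>Basis.
        (inv (T y) v \<bullet> j) *\<^sub>R frechet_derivative (\<lambda>z. T z j) (at y) h) \<bullet> i) *\<^sub>R inv (T y) i))) (at y)"
      by (intro has_derivative_inv_linear[where D = "\<lambda>w. frechet_derivative (\<lambda>z. T z w) (at y)", OF S y]
          lin bij cont)
  qed
qed

section \<open>Smooth inverse functions and a criterion for submanifolds\<close>

text \<open>Bootstrapping: the derivative of the local inverse \<open>g\<close> at \<open>y\<close>
  is the inverse of the derivative of \<open>f\<close> at \<open>g y\<close>. If \<open>g\<close> is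
  of class C^k, so is this expression, hence \<open>g\<close> is of class C^(k+1).\<close>

lemma smooth_inverse_function:
  fixes f :: "'a::euclidean_space \<Rightarrow> 'a"
  assumes S: "open S" "x0 \<in> S" and f: "smooth_on S f"
    and inj: "inj (frechet_derivative f (at x0))"
  obtains U V g where "open U" "U \<subseteq> S" "x0 \<in> U" "open V" "f ` U = V"
    "\<And>x. x \<in> U \<Longrightarrow> g (f x) = x" "smooth_on V g"
proof -
  let ?D = "\<lambda>x. frechet_derivative f (at x)"
  have hd: "higher_diff_on k S f" for k using f by (simp add: smooth_on_def)
  note D = higher_diff_on_SucD[OF hd]
  have bl: "bounded_linear (?D x)" if "x \<in> S" for x
    using D(1)[OF that] by (rule has_derivative_bounded_linear)
  define f' where "f' x = Blinfun (?D x)" for x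
  have f': "blinfun_apply (f' x) = ?D x" if "x \<in> S" for x
    by (simp add: f'_def bounded_linear_Blinfun_apply bl[OF that])
  \<comment> \<open>The inverse function theorem asks for continuity in operator norm; in finite
    dimension continuity at each fixed vector gives it.\<close>
  have "continuous_on S (\<lambda>x. blinfun_apply (f' x) i)" for i
    using D(2)[of 0 i] f' by (simp cong: continuous_on_cong)
  then have cont: "continuous_on S f'"
    by (intro continuous_on_blinfun_componentwise)
  have lin0: "linear (?D x0)" using bl[OF S(2)] by (simp add: bounded_linear.linear)
  then obtain h where h: "linear h" "h \<circ> ?D x0 = id"
    using inj linear_injective_left_inverse by blast
  have inv: "Blinfun h o\<^sub>L f' x0 = id_blinfun"
    using h f'[OF S(2)] by (intro blinfun_eqI)
      (simp add: bounded_linear_Blinfun_apply linear_conv_bounded_linear[symmetric] o_def fun_eq_iff id_def)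
  have der: "(f has_derivative blinfun_apply (f' x)) (at x)" if "x \<in> S" for x
    using D(1)[OF that] f'[OF that] by simp
  obtain U V g g' where U: "open U" "U \<subseteq> S" "x0 \<in> U" and V: "open V"
    and hom: "homeomorphism U V f g"
    and g: "\<And>y. y \<in> V \<Longrightarrow> (g has_derivative g' y) (at y)"
      "\<And>y. y \<in> V \<Longrightarrow> g' y = inv (blinfun_apply (f' (g y)))"
      "\<And>y. y \<in> V \<Longrightarrow> bij (blinfun_apply (f' (g y)))"
    by (rule inverse_function_theorem[OF S(1) der cont S(2) inv]) blast+
  have gV: "g ` V = U" using hom by (simp add: homeomorphism_def)
  then have gS: "g ` V \<subseteq> S" using U by blast
  have gS': "g y \<in> S" if "y \<in> V" for y using gS that by blast
  have "higher_diff_on k V g" for k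
  proof (induction k)
    case 0
    then show ?case using hom by (simp add: homeomorphism_def)
  next
    case (Suc k)
    show ?case
    proof (rule higher_diff_on_SucI[OF V])
      show "(g has_derivative inv (?D (g y))) (at y)" if "y \<in> V" for y
        using g(1,2)[OF that] f'[OF gS'[OF that]] by simp
      have "higher_diff_on k V (\<lambda>y. ?D (g y) w)" for w
        by (rule higher_diff_on_compose[OF V S(1) gS D(2) Suc.IH])
      moreover have "linear (?D (g y))" "bij (?D (g y))" if "y \<in> V" for y
        using bl[OF gS'[OF that]] g(3)[OF that] f'[OF gS'[OF that]] by (simp_all add: bounded_linear.linear)
      ultimately show "higher_diff_on k V (\<lambda>y. inv (?D (g y)) v)" for v
        by (intro higher_diff_on_inv_linear[OF V])
    qed
  qed
  then have "smooth_on V g" by (simp add: smooth_on_def)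
  moreover have "f ` U = V" using hom by (simp add: homeomorphism_def)
  moreover have "g (f x) = x" if "x \<in> U" for x using hom that by (simp add: homeomorphism_def)
  ultimately show ?thesis
    using that[OF U V _ _ \<open>smooth_on V g\<close>] by blast
qed

text \<open>Source and target have equal dimension, so an injective derivative is invertible and a
  globally defined map becomes a chart after shrinking around \<open>p\<close>.\<close>

lemma smooth_embedded_submanifoldI:
  fixes M :: "'a::euclidean_space set"
  assumes "\<And>p. p \<in> M \<Longrightarrow> \<exists>(f :: 'a \<Rightarrow> 'a) f' W. smooth_on UNIV f
    \<and> (f has_derivative f') (at p) \<and> inj f' \<and> subspace W \<and> dim W = k
    \<and> (\<forall>\<^sub>F x in nhds p. x \<in> M \<longleftrightarrow> f x \<in> W)"
  shows "smooth_embedded_submanifold M k"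
  unfolding smooth_embedded_submanifold_def
proof
  fix p assume p: "p \<in> M"
  obtain f :: "'a \<Rightarrow> 'a" and f' W where f: "smooth_on UNIV f" "(f has_derivative f') (at p)" "inj f'"
    and W: "subspace W" "dim W = k" and ev: "\<forall>\<^sub>F x in nhds p. x \<in> M \<longleftrightarrow> f x \<in> W"
    using assms[OF p] by (elim exE conjE)
  obtain S where S: "open S" "p \<in> S" "\<And>x. x \<in> S \<Longrightarrow> x \<in> M \<longleftrightarrow> f x \<in> W"
    using ev by (auto simp: eventually_nhds)
  have fS: "smooth_on S f"
    using f(1) higher_diff_on_subset[OF _ subset_UNIV] by (auto simp: smooth_on_def)
  have "inj (frechet_derivative f (at p))"
    using frechet_derivative_at[OF f(2)] f(3) by simp
  then obtain U V g where U: "open U" "U \<subseteq> S" "p \<in> U" "open V" "f ` U = V"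
    "\<And>x. x \<in> U \<Longrightarrow> g (f x) = x" "smooth_on V g"
    by (rule smooth_inverse_function[OF S(1,2) fS]) blast
  have fU: "smooth_on U f"
    using fS higher_diff_on_subset[OF _ U(2)] by (auto simp: smooth_on_def)
  have fM: "f ` (M \<inter> U) = V \<inter> W" using S(3) U(2,5) by blast
  show "\<exists>U V (\<phi>::'a \<Rightarrow> 'a) \<psi> W. open U \<and> p \<in> U \<and> open V \<and> \<phi> ` U = V \<and>
      (\<forall>x\<in>U. \<psi> (\<phi> x) = x) \<and> smooth_on U \<phi> \<and> smooth_on V \<psi> \<and>
      subspace W \<and> dim W = k \<and> \<phi> ` (M \<inter> U) = V \<inter> W"
    by (intro exI[of _ U] exI[of _ V] exI[of _ f] exI[of _ g] exI[of _ W] conjI ballI U W fU fM)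
qed

subsection \<open>Matrices and centralizers\<close>

lemma transpose_add: "transpose (A + B) = transpose A + transpose (B :: 'a::semiring_1^'n^'m)"
  by (simp add: transpose_def vec_eq_iff)

lemma transpose_diff: "transpose (A - B) = transpose A - transpose (B :: 'a::ring_1^'n^'m)"
  by (simp add: transpose_def vec_eq_iff)

lemma bounded_linear_transpose: "bounded_linear (transpose :: real^'n^'m \<Rightarrow> real^'m^'n)"
  by (intro linear_conv_bounded_linear[THEN iffD1] linearI) (simp_all add: transpose_add transpose_scalar)

lemma bounded_bilinear_matrix_mult:
  "bounded_bilinear ((**) :: real^'n^'m \<Rightarrow> real^'k^'n \<Rightarrow> real^'k^'m)"
  unfolding bilinear_conv_bounded_bilinear[symmetric] bilinear_def
  by (simp add: linear_iff matrix_matrix_mult_def vec_eq_iff distrib_left distrib_right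
      sum.distrib sum_distrib_left mult_ac)

interpretation matrix_mult: bounded_bilinear "(**) :: real^'n^'m \<Rightarrow> real^'k^'n \<Rightarrow> real^'k^'m"
  by (rule bounded_bilinear_matrix_mult)

lemma invertible_matrix_inv:
  fixes A :: "real^'n^'n"
  assumes "invertible A"
  shows "A ** matrix_inv A = mat 1" "matrix_inv A ** A = mat 1"
  using someI_ex[OF assms[unfolded invertible_def]] by (simp_all add: matrix_inv_def)

text \<open>One-sided inverses of square matrices are two-sided. The nested products let the rule
  cancel inside chains associated to the right.\<close>

lemma matrix_cancel_left:
  fixes A X :: "real^'n^'n"
  assumes "A ** B = mat 1"
  shows "A ** (B ** X) = X" "B ** (A ** X) = X"
  using assms matrix_left_right_inverse[of A B] by (simp_all add: matrix_mul_assoc)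

lemma eventually_invertible: "\<forall>\<^sub>F A in nhds (mat 1 :: real^'n^'n). invertible A"
proof -
  have "isCont det (mat 1 :: real^'n^'n)"
    unfolding det_def by (intro continuous_intros continuous_component)
  then have "(det \<longlongrightarrow> 1) (nhds (mat 1 :: real^'n^'n))"
    using tendsto_at_iff_tendsto_nhds[of det "mat 1 :: real^'n^'n"] by (simp add: isCont_def)
  then have "\<forall>\<^sub>F A in nhds (mat 1 :: real^'n^'n). det A \<noteq> 0"
    by (rule tendsto_imp_eventually_ne) simp
  then show ?thesis by (simp add: invertible_det_nz)
qed

section \<open>Centralizer algebras\<close>

text \<open>Both algebras of the opening sketch have this form: Z(E) is \<open>blocks c\<close> and
  Z(Q) is \<open>centralizer (conj_projs c p)\<close>, so one set of closure rules serves
  both.\<close>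

definition centralizer :: "(real^'n^'n) set \<Rightarrow> (real^'n^'n) set" where
  "centralizer K = {X. \<forall>E\<in>K. E ** X = X ** E}"

lemma centralizerI: "(\<And>E. E \<in> K \<Longrightarrow> E ** X = X ** E) \<Longrightarrow> X \<in> centralizer K"
  and centralizerD: "X \<in> centralizer K \<Longrightarrow> E \<in> K \<Longrightarrow> E ** X = X ** E"
  by (auto simp: centralizer_def)

lemma centralizer_one: "mat 1 \<in> centralizer K"
  by (simp add: centralizer_def)

lemma centralizer_mult: "X \<in> centralizer K \<Longrightarrow> Y \<in> centralizer K \<Longrightarrow> X ** Y \<in> centralizer K"
  by (auto intro!: centralizerI simp: matrix_mul_assoc centralizerD[of X])
    (simp add: centralizerD[of Y] flip: matrix_mul_assoc)

lemma centralizer_add: "X \<in> centralizer K \<Longrightarrow> Y \<in> centralizer K \<Longrightarrow> X + Y \<in> centralizer K"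
  by (simp add: centralizer_def matrix_mult.add_left matrix_mult.add_right)

lemma centralizer_diff: "X \<in> centralizer K \<Longrightarrow> Y \<in> centralizer K \<Longrightarrow> X - Y \<in> centralizer K"
  by (simp add: centralizer_def matrix_mult.diff_left matrix_mult.diff_right)

lemma centralizer_sum: "(\<And>i. i \<in> I \<Longrightarrow> f i \<in> centralizer K) \<Longrightarrow> sum f I \<in> centralizer K"
  by (induction I rule: infinite_finite_induct)
    (simp_all add: centralizer_add, simp_all add: centralizer_def)

lemma subspace_centralizer: "subspace (centralizer K)"
  unfolding subspace_def
  by (simp add: centralizer_def matrix_mult.add_left matrix_mult.add_right
      matrix_mult.scaleR_left matrix_mult.scaleR_right)

lemma centralizer_inverse:
  assumes X: "X \<in> centralizer K" and inv: "X ** Y = mat 1"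
  shows "Y \<in> centralizer K"
proof (rule centralizerI)
  fix E assume "E \<in> K"
  note comm = centralizerD[OF X this]
  have "Y ** E = Y ** (E ** (X ** Y))" by (simp add: inv)
  also have "\<dots> = Y ** (X ** (E ** Y))" using comm by (simp add: matrix_mul_assoc)
  also have "\<dots> = E ** Y" by (rule matrix_cancel_left[OF inv])
  finally show "E ** Y = Y ** E" ..
qed

lemma centralizer_transpose:
  assumes "\<And>E. E \<in> K \<Longrightarrow> transpose E = E" "X \<in> centralizer K"
  shows "transpose X \<in> centralizer K"
proof (rule centralizerI)
  fix E assume E: "E \<in> K"
  have "transpose (X ** E) = transpose (E ** X)" by (simp add: centralizerD[OF assms(2) E])
  then show "E ** transpose X = transpose X ** E" by (simp add: matrix_transpose_mul assms(1)[OF E])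
qed

section \<open>Block projections and the block-diagonal part\<close>

text \<open>The map \<open>c\<close> colours the indices and the blocks are its colour classes. A
  colour \<open>m\<close> outside the range of \<open>c\<close> gives the zero matrix.\<close>

definition block_proj :: "('n \<Rightarrow> 'k) \<Rightarrow> 'k \<Rightarrow> real^'n^'n" where
  "block_proj c m = (\<chi> i j. if i = j \<and> c i = m then 1 else 0)"

definition block_part :: "('n \<Rightarrow> 'k) \<Rightarrow> real^'n^'n \<Rightarrow> real^'n^'n" where
  "block_part c X = (\<chi> i j. if c i = c j then X $ i $ j else 0)"

abbreviation blocks :: "('n::finite \<Rightarrow> 'k) \<Rightarrow> (real^'n^'n) set" where
  "blocks c \<equiv> centralizer (range (block_proj c))"

lemma block_proj_mult_left: "(block_proj c m ** X) $ i $ j = (if c i = m then X $ i $ j else 0)"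
proof -
  have "(block_proj c m ** X) $ i $ j = (\<Sum>k\<in>UNIV. if i = k then (if c i = m then X $ k $ j else 0) else 0)"
    unfolding matrix_matrix_mult_def block_proj_def by (simp add: if_distrib cong: if_cong) (intro sum.cong; simp)
  then show ?thesis by simp
qed

lemma block_proj_mult_right: "(X ** block_proj c m) $ i $ j = (if c j = m then X $ i $ j else 0)"
proof -
  have "(X ** block_proj c m) $ i $ j = (\<Sum>k\<in>UNIV. if j = k then (if c j = m then X $ i $ k else 0) else 0)"
    unfolding matrix_matrix_mult_def block_proj_def by (simp add: if_distrib cong: if_cong) (intro sum.cong; auto)
  then show ?thesis by simp
qed

lemma transpose_block_proj: "transpose (block_proj c m) = block_proj c m"
  by (auto simp: transpose_def block_proj_def vec_eq_iff)

lemma block_proj_idem: "block_proj c m ** block_proj c m = block_proj c m"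
  by (simp add: vec_eq_iff block_proj_mult_left) (simp add: block_proj_def)

lemma in_blocks_iff: "X \<in> blocks c \<longleftrightarrow> (\<forall>i j. c i \<noteq> c j \<longrightarrow> X $ i $ j = 0)"
  unfolding centralizer_def by (auto simp: vec_eq_iff block_proj_mult_left block_proj_mult_right)

lemma in_blocks_iff_block_part: "X \<in> blocks c \<longleftrightarrow> block_part c X = X"
  by (auto simp: in_blocks_iff block_part_def vec_eq_iff)

lemma block_part_in_blocks: "block_part c X \<in> blocks c"
  by (simp add: in_blocks_iff block_part_def)

lemma block_part_one: "block_part c (mat 1) = mat 1"
  by (auto simp: block_part_def mat_def vec_eq_iff)

lemma block_part_transpose: "block_part c (transpose X) = transpose (block_part c X)"
  by (auto simp: block_part_def transpose_def vec_eq_iff)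

lemma block_part_add: "block_part c (X + Y) = block_part c X + block_part c Y"
  by (auto simp: block_part_def vec_eq_iff)

lemma block_part_scaleR: "block_part c (r *\<^sub>R X) = r *\<^sub>R block_part c X"
  by (auto simp: block_part_def vec_eq_iff)

lemma block_part_diff: "block_part c (X - Y) = block_part c X - block_part c Y"
  by (auto simp: block_part_def vec_eq_iff)

lemma bounded_linear_block_part: "bounded_linear (block_part c :: real^'n^'n \<Rightarrow> real^'n^'n)"
  by (intro linear_conv_bounded_linear[THEN iffD1] linearI) (auto simp: block_part_def vec_eq_iff)

text \<open>As a sum of compressions, the entrywise truncation is a bimodule map over
  \<open>blocks c\<close> and preserves every centralizer that contains the projections.\<close>

lemma block_part_eq_sum:
  fixes X :: "real^'n^'n"
  shows "block_part c X = (\<Sum>m\<in>range c. block_proj c m ** X ** block_proj c m)"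
  by (simp add: vec_eq_iff block_part_def block_proj_mult_left block_proj_mult_right cong: if_cong)

lemma block_part_mult_left:
  assumes "L \<in> blocks c"
  shows "block_part c (L ** X) = L ** block_part c X"
proof -
  have "block_proj c m ** (L ** X) ** block_proj c m = L ** (block_proj c m ** X ** block_proj c m)" for m
    using centralizerD[OF assms, of "block_proj c m"] by (simp add: matrix_mul_assoc)
  then show ?thesis by (simp add: block_part_eq_sum matrix_mult.sum_right)
qed

lemma block_part_mult_right:
  assumes "L \<in> blocks c"
  shows "block_part c (X ** L) = block_part c X ** L"
proof -
  have "block_proj c m ** (X ** L) ** block_proj c m = block_proj c m ** X ** block_proj c m ** L" for m
    using centralizerD[OF assms, of "block_proj c m"] by (simp flip: matrix_mul_assoc)
  then show ?thesis by (simp add: block_part_eq_sum matrix_mult.sum_left)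
qed

lemma block_part_in_centralizer:
  assumes "\<And>m. block_proj c m \<in> centralizer K" "X \<in> centralizer K"
  shows "block_part c X \<in> centralizer K"
  unfolding block_part_eq_sum by (intro centralizer_sum centralizer_mult assms)

subsection \<open>The straightening map\<close>

lemma block_part_inner_le:
  fixes X :: "real^'n^'n"
  shows "block_part c X \<bullet> X \<le> X \<bullet> X"
  unfolding inner_vec_def block_part_def by (intro sum_mono) auto

lemma eventually_norm_less:
  fixes f :: "'a::topological_space \<Rightarrow> 'b::real_normed_vector"
  assumes "(f \<longlongrightarrow> 0) F" "e > 0"
  shows "\<forall>\<^sub>F x in F. norm (f x) < e"
  using tendstoD[OF assms] by simp

text \<open>At B = I, to first order, the equation reads 2 D = \<open>block_part c D\<close>, which
  forces D = 0 because the truncation does not increase norms. The remaining terms \<open>E\<close>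
  have norm at most 3 e K times that of \<open>D\<close>; pairing with \<open>D\<close> shows that
  they cannot compensate.\<close>

lemma small_perturbation_eq_zero:
  fixes B D :: "real^'n^'n"
  assumes K: "\<And>(X :: real^'n^'n) (Y :: real^'n^'n). norm (X ** Y) \<le> norm X * norm Y * K" and "e \<ge> 0" "3 * e * K < 1"
    and small: "norm (B - mat 1) \<le> e" "norm (transpose B - mat 1) \<le> e" "norm D \<le> e"
    and eq: "B ** D + D ** transpose B + D ** D = block_part c D"
  shows "D = 0"
proof (rule ccontr)
  assume "D \<noteq> 0"
  let ?d = "norm D"
  define E where "E = (B - mat 1) ** D + D ** (transpose B - mat 1) + D ** D"
  \<comment> \<open>The sign of \<open>K\<close> comes from the product bound at the nonzero matrix
    \<open>D\<close>.\<close>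
  have "0 \<le> ?d * ?d * K"
    using K[of D D] norm_ge_zero order_trans by blast
  moreover have "?d * ?d > 0" using \<open>D \<noteq> 0\<close> by simp
  ultimately have K0: "0 \<le> K" using zero_le_mult_iff[of "?d * ?d" K] by linarith
  have b: "norm (X ** Y) \<le> e * ?d * K" if "norm X \<le> e \<and> norm Y \<le> ?d \<or> norm X \<le> ?d \<and> norm Y \<le> e" for X Y :: "real^'n^'n"
  proof -
    have "norm X * norm Y \<le> e * ?d"
      using that \<open>e \<ge> 0\<close> mult_mono[of "norm X" e "norm Y" ?d] mult_mono[of "norm X" ?d "norm Y" e]
      by (auto simp: mult.commute)
    then show ?thesis using K[of X Y] mult_right_mono[OF _ K0] by (meson order_trans)
  qed
  have "norm E \<le> norm ((B - mat 1) ** D) + norm (D ** (transpose B - mat 1)) + norm (D ** D)"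
    unfolding E_def by (meson norm_triangle_ineq norm_triangle_mono order_refl)
  also have "\<dots> \<le> 3 * (e * ?d * K)"
    using b[of "B - mat 1" D] b[of D "transpose B - mat 1"] b[of D D] small by simp
  finally have nE: "norm E \<le> 3 * e * K * ?d" by (simp add: mult_ac)
  have E: "E = block_part c D - 2 *\<^sub>R D"
    unfolding E_def eq[symmetric]
    by (simp add: matrix_mult.diff_left matrix_mult.diff_right scaleR_2)
  have "?d * ?d \<le> - (E \<bullet> D)"
    using block_part_inner_le[of c D] unfolding E by (simp add: inner_diff_left norm_eq_sqrt_inner)
  also have "\<dots> \<le> norm E * ?d" using Cauchy_Schwarz_ineq2[of E D] by linarith
  also have "\<dots> \<le> 3 * e * K * ?d * ?d" using nE by (intro mult_right_mono) auto
  finally have "?d * ?d \<le> (3 * e * K) * (?d * ?d)" by (simp add: mult_ac)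
  moreover have "(3 * e * K) * (?d * ?d) < 1 * (?d * ?d)"
    using assms(3) \<open>D \<noteq> 0\<close> by (intro mult_strict_right_mono) auto
  ultimately show False by simp
qed

text \<open>Since \<open>S\<close> is block-diagonal and an involution, S B S solves the same
  equation as \<open>B\<close>. The skew parts agree, so the difference \<open>D\<close> is
  symmetric; subtracting the two equations gives the perturbation equation above, and
  \<open>D\<close> is small near the identity.\<close>

lemma eventually_reflection_commutes:
  fixes S :: "real^'n^'n"
  assumes S: "S \<in> blocks c" "transpose S = S" "S ** S = mat 1"
  shows "\<forall>\<^sub>F B in nhds (mat 1). B ** transpose B = block_part c B \<longrightarrow>
    S ** (B - transpose B) = (B - transpose B) ** S \<longrightarrow> S ** B = B ** S"
proof -
  obtain K where K: "K > 0" "\<And>(X :: real^'n^'n) (Y :: real^'n^'n). norm (X ** Y) \<le> norm X * norm Y * K"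
    using matrix_mult.pos_bounded by blast
  \<comment> \<open>This choice makes \<open>3 * e * K\<close> equal to 3/4.\<close>
  define e where "e = 1 / (4 * K)"
  have e: "e > 0" "3 * e * K < 1" using K(1) by (simp_all add: e_def)
  note tend = tendsto_diff matrix_mult.tendsto tendsto_const bounded_linear.tendsto[OF bounded_linear_transpose] filterlim_ident
  have "((\<lambda>B. B - mat 1) \<longlongrightarrow> mat 1 - mat 1) (nhds (mat 1 :: real^'n^'n))"
    by (intro tend)
  then have ev1: "\<forall>\<^sub>F B in nhds (mat 1 :: real^'n^'n). norm (B - mat 1) < e"
    using e by (intro eventually_norm_less) simp_all
  have "((\<lambda>B. transpose B - mat 1) \<longlongrightarrow> transpose (mat 1) - mat 1) (nhds (mat 1 :: real^'n^'n))"
    by (intro tend)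
  then have ev2: "\<forall>\<^sub>F B in nhds (mat 1 :: real^'n^'n). norm (transpose B - mat 1) < e"
    using e by (intro eventually_norm_less) simp_all
  have "((\<lambda>B. S ** B ** S - B) \<longlongrightarrow> S ** mat 1 ** S - mat 1) (nhds (mat 1 :: real^'n^'n))"
    by (intro tend)
  then have ev3: "\<forall>\<^sub>F B in nhds (mat 1 :: real^'n^'n). norm (S ** B ** S - B) < e"
    using e S(3) by (intro eventually_norm_less) simp_all
  show ?thesis
    using ev1 ev2 ev3
  proof eventually_elim
    fix B :: "real^'n^'n"
    assume small: "norm (B - mat 1) < e" "norm (transpose B - mat 1) < e" "norm (S ** B ** S - B) < e"
    show "B ** transpose B = block_part c B \<longrightarrow>
      S ** (B - transpose B) = (B - transpose B) ** S \<longrightarrow> S ** B = B ** S"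
    proof (intro impI)
      assume B: "B ** transpose B = block_part c B"
        and comm: "S ** (B - transpose B) = (B - transpose B) ** S"
      define D where "D = S ** B ** S - B"
      have SS: "S ** (S ** X) = X" for X :: "real^'n^'n"
        by (rule matrix_cancel_left[OF S(3)])
      have "S ** (B - transpose B) ** S = B - transpose B"
        using comm S(3) by (simp flip: matrix_mul_assoc)
      then have DT: "transpose D = D"
        unfolding D_def
        by (simp add: transpose_diff matrix_transpose_mul S(2) matrix_mult.diff_left matrix_mult.diff_right
            matrix_mul_assoc algebra_simps)
      have "(B + D) ** transpose (B + D) = S ** (B ** transpose B) ** S"
        unfolding D_def by (simp add: matrix_transpose_mul S(2) SS flip: matrix_mul_assoc)
      also have "\<dots> = block_part c (S ** B ** S)"
        by (simp add: B block_part_mult_left[OF S(1)] block_part_mult_right[OF S(1)])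
      also have "\<dots> = block_part c (B + D)" by (simp add: D_def)
      finally have "B ** D + D ** transpose B + D ** D = block_part c (B + D) - block_part c B"
        by (simp add: transpose_add DT B matrix_mult.add_left matrix_mult.add_right algebra_simps)
      also have "\<dots> = block_part c D" by (simp flip: block_part_diff)
      finally have "D = 0"
        using small K(2) e by (intro small_perturbation_eq_zero[of K e B D c]) (auto simp: D_def)
      then have "S ** (S ** B ** S) = S ** B" by (simp add: D_def)
      then show "S ** B = B ** S" by (simp add: SS flip: matrix_mul_assoc)
    qed
  qed
qed

section \<open>The chart and its model space\<close>

definition chart :: "('n \<Rightarrow> 'k) \<Rightarrow> real^'n^'n \<Rightarrow> real^'n^'n" where
  "chart c C = transpose C ** C - mat 1
    + (block_part c C - transpose (block_part c C))
    + (transpose (block_part c C) ** C - transpose C ** block_part c C)"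

text \<open>When \<open>block_part c\<close> preserves \<open>centralizer K\<close>, this is the sum
  of the skew parts of \<open>blocks c\<close> and \<open>centralizer K\<close>, written without an
  existential over the summands.\<close>

definition model_space :: "('n \<Rightarrow> 'k) \<Rightarrow> (real^'n^'n) set \<Rightarrow> (real^'n^'n) set" where
  "model_space c K = {Y. transpose Y = - Y \<and> Y - block_part c Y \<in> centralizer K}"

lemma smooth_chart:
  assumes "bounded_linear T"
  shows "smooth_on UNIV (\<lambda>X. chart c (T X))"
  unfolding smooth_on_def chart_def
  by (intro allI higher_diff_on_add higher_diff_on_diff higher_diff_on_const
      higher_diff_on_bilinear[OF bounded_bilinear_matrix_mult]
      higher_diff_on_bounded_linear[OF bounded_linear_transpose]
      higher_diff_on_bounded_linear[OF bounded_linear_block_part]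
      higher_diff_on_bounded_linear[OF assms] higher_diff_on_ident open_UNIV)

text \<open>With a the block part of h, the three terms contribute h^T + h, a - a^T and a^T + h -
  h^T - a, which add up to 2 h.\<close>

lemma has_derivative_chart:
  "(chart c has_derivative (\<lambda>h. 2 *\<^sub>R h)) (at (mat 1 :: real^'n^'n))"
proof -
  note T = bounded_linear.has_derivative[OF bounded_linear_transpose]
  note P = bounded_linear.has_derivative[OF bounded_linear_block_part]
  note M = bounded_bilinear.FDERIV[OF bounded_bilinear_matrix_mult]
  show ?thesis
    unfolding chart_def
    by (rule has_derivative_eq_rhs,
        (rule has_derivative_add has_derivative_diff T P M has_derivative_const has_derivative_ident)+)
      (auto simp: fun_eq_iff block_part_one scaleR_2 algebra_simps)
qed

lemma subspace_model_space:
  fixes c :: "'n::finite \<Rightarrow> 'k"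
  shows "subspace (model_space c K)"
proof (rule subspaceI)
  have "block_part c 0 = 0" "transpose (0 :: real^'n^'n) = 0"
    by (simp_all add: block_part_def transpose_def vec_eq_iff)
  then show "0 \<in> model_space c K"
    using subspace_0[OF subspace_centralizer, of K] by (simp add: model_space_def)
next
  fix X Y assume XY: "X \<in> model_space c K" "Y \<in> model_space c K"
  have "(X + Y) - block_part c (X + Y) = (X - block_part c X) + (Y - block_part c Y)"
    by (simp add: block_part_add)
  also have "\<dots> \<in> centralizer K"
    using XY by (intro centralizer_add) (simp_all add: model_space_def)
  finally show "X + Y \<in> model_space c K"
    using XY by (simp add: model_space_def transpose_add)
next
  fix X r assume X: "X \<in> model_space c K"
  have "r *\<^sub>R X - block_part c (r *\<^sub>R X) = r *\<^sub>R (X - block_part c X)"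
    by (simp add: block_part_scaleR scaleR_right_diff_distrib)
  then show "r *\<^sub>R X \<in> model_space c K"
    using X by (simp add: model_space_def transpose_scalar subspace_scale[OF subspace_centralizer])
qed

text \<open>The last two terms of the chart are skew, so its symmetric part is C^T C - I. Once this
  vanishes, subtracting the block part leaves exactly the third term, because the block part A^T A
  of A^T C is symmetric.\<close>

lemma chart_in_model_space_iff:
  "chart c C \<in> model_space c K \<longleftrightarrow> transpose C ** C = mat 1 \<and>
    transpose (block_part c C) ** C - transpose C ** block_part c C \<in> centralizer K"
proof -
  let ?A = "block_part c C"
  have "chart c C + transpose (chart c C) = 2 *\<^sub>R (transpose C ** C - mat 1)"
    by (simp add: chart_def transpose_add transpose_diff matrix_transpose_mul scaleR_2)
  moreover have "transpose (chart c C) = - chart c C \<longleftrightarrow> chart c C + transpose (chart c C) = 0"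
    by (metis add_eq_0_iff)
  ultimately have orth: "transpose (chart c C) = - chart c C \<longleftrightarrow> transpose C ** C = mat 1" by simp
  have A: "?A \<in> blocks c" "transpose ?A \<in> blocks c"
    using block_part_in_blocks block_part_in_blocks[of c "transpose C"] by (auto simp: block_part_transpose)
  have "chart c C - block_part c (chart c C) = transpose ?A ** C - transpose C ** ?A"
    if "transpose C ** C = mat 1"
  proof -
    have "transpose C ** ?A = transpose (transpose ?A ** C)" by (simp add: matrix_transpose_mul)
    then have "block_part c (transpose C ** ?A) = transpose ?A ** ?A"
      using block_part_mult_left[OF A(2), of C] block_part_transpose[of c "transpose ?A ** C"]
      by (simp add: matrix_transpose_mul)
    moreover have "block_part c ?A = ?A" "block_part c (transpose ?A) = transpose ?A"
      using A by (simp_all add: in_blocks_iff_block_part)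
    ultimately have "block_part c (chart c C) = ?A - transpose ?A"
      using that block_part_mult_left[OF A(2), of C]
      by (simp add: chart_def block_part_add block_part_diff)
    then show ?thesis using that by (simp add: chart_def)
  qed
  then show ?thesis using orth by (auto simp: model_space_def)
qed

text \<open>Closeness to the identity is used twice: to invert the block part of \<open>C\<close>,
  and to apply rigidity to \<open>B C\<close>. As \<open>K\<close> is finite, the neighbourhoods for
  its single elements can be intersected.\<close>

lemma eventually_chart_iff:
  fixes K :: "(real^'n^'n) set" and c :: "'n \<Rightarrow> 'k"
  assumes fin: "finite K" and K: "\<And>Q. Q \<in> K \<Longrightarrow> transpose Q = Q" "\<And>Q. Q \<in> K \<Longrightarrow> Q ** Q = Q"
    "\<And>Q. Q \<in> K \<Longrightarrow> Q \<in> blocks c"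
  shows "\<forall>\<^sub>F C in nhds (mat 1). chart c C \<in> model_space c K \<longleftrightarrow>
    transpose C ** C = mat 1 \<and> (\<exists>L\<in>blocks c. \<exists>R\<in>centralizer K. C = L ** R)"
proof -
  define B where "B C = transpose (block_part c C) ** C" for C :: "real^'n^'n"
  \<comment> \<open>Commutation of \<open>Q\<close> with the block projections, read from the other
    side; hence \<open>block_part c\<close> preserves \<open>centralizer K\<close>.\<close>
  have proj: "block_proj c m \<in> centralizer K" for m
    using K(3) by (intro centralizerI) (metis centralizerD rangeI)
  note tr = centralizer_transpose[OF K(1)]
  have "((\<lambda>C. transpose (block_part c C) ** C) \<longlongrightarrow> transpose (block_part c (mat 1)) ** mat 1) (nhds (mat 1))"
    by (intro matrix_mult.tendsto bounded_linear.tendsto[OF bounded_linear_transpose]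
        bounded_linear.tendsto[OF bounded_linear_block_part] filterlim_ident)
  then have limB: "filterlim B (nhds (mat 1)) (nhds (mat 1))"
    by (simp add: B_def[abs_def] block_part_one)
  have "(block_part c \<longlongrightarrow> block_part c (mat 1)) (nhds (mat 1))"
    by (intro bounded_linear.tendsto[OF bounded_linear_block_part] filterlim_ident)
  then have "filterlim (block_part c) (nhds (mat 1 :: real^'n^'n)) (nhds (mat 1))"
    by (simp add: block_part_one)
  then have ev_inv: "\<forall>\<^sub>F C :: real^'n^'n in nhds (mat 1). invertible (block_part c C)"
    by (rule eventually_compose_filterlim[OF eventually_invertible])
  \<comment> \<open>Rigidity asks for an involution, so \<open>Q\<close> is replaced by the
    reflection I - 2 Q, which commutes with the same matrices.\<close>
  define S where "S Q = mat 1 - 2 *\<^sub>R Q" for Q :: "real^'n^'n"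
  have S_comm: "S Q ** X = X ** S Q \<longleftrightarrow> Q ** X = X ** Q" for Q X
    by (simp add: S_def matrix_mult.diff_left matrix_mult.diff_right
        matrix_mult.scaleR_left matrix_mult.scaleR_right)
  have "\<forall>\<^sub>F B in nhds (mat 1). B ** transpose B = block_part c B \<longrightarrow>
      S Q ** (B - transpose B) = (B - transpose B) ** S Q \<longrightarrow> S Q ** B = B ** S Q" if Q: "Q \<in> K" for Q
  proof (rule eventually_reflection_commutes)
    show "S Q \<in> blocks c"
      unfolding S_def using subspace_centralizer centralizer_one K(3)[OF Q]
      by (intro centralizer_diff subspace_scale)
    show "transpose (S Q) = S Q" by (simp add: S_def transpose_diff transpose_scalar K(1)[OF Q])
    show "S Q ** S Q = mat 1"
    proof -
      have "a - 2 *\<^sub>R b - 2 *\<^sub>R (b - 2 *\<^sub>R b) = a" for a b :: "'v::real_vector"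
        by (simp add: scaleR_2)
      then show ?thesis
        by (simp only: S_def matrix_mult.diff_left matrix_mult.diff_right matrix_mult.scaleR_left
            matrix_mult.scaleR_right K(2)[OF Q] matrix_mul_lid matrix_mul_rid)
    qed
  qed
  then have "\<forall>\<^sub>F B in nhds (mat 1). \<forall>Q\<in>K. B ** transpose B = block_part c B \<longrightarrow>
      Q ** (B - transpose B) = (B - transpose B) ** Q \<longrightarrow> Q ** B = B ** Q"
    unfolding S_comm by (intro eventually_ball_finite fin) blast
  then have "\<forall>\<^sub>F C in nhds (mat 1). \<forall>Q\<in>K. B C ** transpose (B C) = block_part c (B C) \<longrightarrow>
      Q ** (B C - transpose (B C)) = (B C - transpose (B C)) ** Q \<longrightarrow> Q ** B C = B C ** Q"
    by (rule eventually_compose_filterlim[OF _ limB])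
  then show ?thesis using ev_inv
  proof eventually_elim
    fix C :: "real^'n^'n"
    assume uniq: "\<forall>Q\<in>K. B C ** transpose (B C) = block_part c (B C) \<longrightarrow>
      Q ** (B C - transpose (B C)) = (B C - transpose (B C)) ** Q \<longrightarrow> Q ** B C = B C ** Q"
      and inv: "invertible (block_part c C)"
    let ?A = "block_part c C"
    obtain A' where A': "?A ** A' = mat 1" "A' ** ?A = mat 1"
      using invertible_matrix_inv[OF inv] by blast
    have tA': "transpose A' ** transpose ?A = mat 1" "transpose ?A ** transpose A' = mat 1"
      using A' by (metis matrix_transpose_mul transpose_mat)+
    have gram_inv: "(transpose ?A ** ?A) ** (A' ** transpose A') = mat 1"
      using tA' matrix_cancel_left[OF A'(1)] by (simp flip: matrix_mul_assoc)
    have BT: "B C - transpose (B C) = transpose ?A ** C - transpose C ** ?A"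
      by (simp add: B_def matrix_transpose_mul)
    have "transpose ?A \<in> blocks c"
      using block_part_in_blocks[of c "transpose C"] by (simp add: block_part_transpose)
    then have bdB: "block_part c (B C) = transpose ?A ** ?A"
      by (simp add: B_def block_part_mult_left)
    show "chart c C \<in> model_space c K \<longleftrightarrow>
      transpose C ** C = mat 1 \<and> (\<exists>L\<in>blocks c. \<exists>R\<in>centralizer K. C = L ** R)"
      unfolding chart_in_model_space_iff BT[symmetric]
    proof (intro conj_cong refl iffI)
      assume "transpose C ** C = mat 1"
      then have C: "C ** transpose C = mat 1" by (simp add: matrix_left_right_inverse)
      {
        \<comment> \<open>Rigidity puts \<open>B C\<close> into the algebra. Its block part A^T A
          follows, then the inverse of that, and finally A^-1 C = (A^T A)^-1 B.\<close>
        assume cen: "B C - transpose (B C) \<in> centralizer K"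
        have "B C ** transpose (B C) = block_part c (B C)"
          unfolding bdB using matrix_cancel_left[OF C]
          by (simp add: B_def matrix_transpose_mul flip: matrix_mul_assoc)
        then have BK: "B C \<in> centralizer K"
          using uniq centralizerD[OF cen] by (auto intro: centralizerI)
        then have "transpose ?A ** ?A \<in> centralizer K"
          using block_part_in_centralizer[of c K, OF proj] bdB by metis
        then have "A' ** transpose A' \<in> centralizer K"
          using gram_inv by (rule centralizer_inverse)
        then have "A' ** transpose A' ** B C \<in> centralizer K"
          using BK by (rule centralizer_mult)
        moreover have "C = ?A ** (A' ** transpose A' ** B C)"
          using matrix_cancel_left[OF A'(1)] matrix_cancel_left[OF tA'(1)]
          by (simp add: B_def flip: matrix_mul_assoc)
        ultimately show "\<exists>L\<in>blocks c. \<exists>R\<in>centralizer K. C = L ** R"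
          using block_part_in_blocks by blast
      }
      {
        assume "\<exists>L\<in>blocks c. \<exists>R\<in>centralizer K. C = L ** R"
        then obtain L R where LR: "L \<in> blocks c" "R \<in> centralizer K" "C = L ** R" by blast
        \<comment> \<open>From A = L \<open>block_part c R\<close> the matrix A^-1 L is the inverse
          of \<open>block_part c R\<close>, so it lies in the algebra, and with it G = A^-1 C.
          Orthogonality of \<open>C\<close> gives A^-1 A^-T = G G^T, and B = (A^T A) G.\<close>
        have A_eq: "?A = L ** block_part c R" by (simp add: LR block_part_mult_left)
        have "block_part c R \<in> centralizer K"
          by (rule block_part_in_centralizer[OF proj LR(2)])
        have LR': "(A' ** L) ** block_part c R = mat 1"
          using A'(2) A_eq by (simp add: matrix_mul_assoc)
        then have "block_part c R ** (A' ** L) = mat 1"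
          by (simp add: matrix_left_right_inverse)
        then have "A' ** L \<in> centralizer K"
          by (rule centralizer_inverse[OF \<open>block_part c R \<in> centralizer K\<close>])
        then have G: "A' ** C \<in> centralizer K"
          using centralizer_mult[OF _ LR(2)] by (simp add: LR(3) matrix_mul_assoc)
        have "A' ** transpose A' = (A' ** C) ** transpose (A' ** C)"
          using matrix_cancel_left[OF C] by (simp add: matrix_transpose_mul flip: matrix_mul_assoc)
        then have "A' ** transpose A' \<in> centralizer K"
          using centralizer_mult[OF G tr[OF _ G]] by simp
        moreover have "(A' ** transpose A') ** (transpose ?A ** ?A) = mat 1"
          using gram_inv by (simp add: matrix_left_right_inverse)
        ultimately have "transpose ?A ** ?A \<in> centralizer K"
          by (rule centralizer_inverse)
        then have "transpose ?A ** ?A ** (A' ** C) \<in> centralizer K"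
          using G by (rule centralizer_mult)
        moreover have "B C = transpose ?A ** ?A ** (A' ** C)"
          using matrix_cancel_left[OF A'(1)] by (simp add: B_def flip: matrix_mul_assoc)
        ultimately show "B C - transpose (B C) \<in> centralizer K"
          by (metis centralizer_diff tr)
      }
    qed
  qed
qed

subsection \<open>Orbits of a permutation matrix\<close>

lemma permutation_matrix_mult_transpose:
  fixes P :: "real^'n^'n"
  assumes "permutation_matrix P"
  shows "P ** transpose P = mat 1"
proof -
  obtain \<sigma> where \<sigma>: "\<sigma> permutes (UNIV :: 'n set)" "P = (\<chi> i j. if \<sigma> i = j then 1 else 0)"
    using assms unfolding permutation_matrix_def by blast
  have "\<sigma> i = \<sigma> j \<longleftrightarrow> i = j" for i j using permutes_inj[OF \<sigma>(1)] by (simp add: inj_eq)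
  then show ?thesis
    by (simp add: vec_eq_iff matrix_matrix_mult_def transpose_def \<sigma>(2) mat_def
        if_distrib[of "\<lambda>x. x * _"] cong: if_cong)
qed

text \<open>The conjugate is a diagonal matrix, hence block-diagonal for every colouring
  \<open>d\<close>.\<close>

lemma permutation_matrix_conj_block_proj:
  fixes P :: "real^'n^'n"
  assumes "permutation_matrix P"
  shows "P ** block_proj c m ** transpose P \<in> blocks d"
proof -
  obtain \<sigma> where \<sigma>: "\<sigma> permutes (UNIV :: 'n set)" "P = (\<chi> i j. if \<sigma> i = j then 1 else 0)"
    using assms unfolding permutation_matrix_def by blast
  have inj: "\<sigma> i = \<sigma> j \<longleftrightarrow> i = j" for i j using permutes_inj[OF \<sigma>(1)] by (simp add: inj_eq)
  have "(P ** block_proj c m) $ i $ k * transpose P $ k $ j = 0" if "i \<noteq> j" for i j k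
    using that inj by (auto simp: block_proj_mult_right transpose_def \<sigma>(2))
  then have "(P ** block_proj c m ** transpose P) $ i $ j = 0" if "i \<noteq> j" for i j
    unfolding matrix_matrix_mult_def[of "P ** block_proj c m"] using that
    by (simp add: sum.neutral del: mult_eq_0_iff)
  then show ?thesis unfolding in_blocks_iff by metis
qed

lemma invertible_of_mult3:
  fixes A B C :: "real^'n^'n"
  assumes "invertible (A ** B ** C)"
  shows "invertible A" "invertible C"
  using assms by (simp_all add: invertible_det_nz det_mul)

definition conj_projs :: "('n \<Rightarrow> 'k) \<Rightarrow> real^'n^'n \<Rightarrow> (real^'n^'n) set" where
  "conj_projs c p = range (\<lambda>m. p ** block_proj c m ** transpose p)"

text \<open>The colour type may be infinite, but all colours outside the range of \<open>c\<close>
  give 0.\<close>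

lemma finite_range_block_proj: "finite (range (block_proj c :: 'k \<Rightarrow> real^'n^'n))"
proof (rule finite_subset)
  show "range (block_proj c :: 'k \<Rightarrow> real^'n^'n) \<subseteq> insert 0 (block_proj c ` range c)"
    by (auto simp: block_proj_def vec_eq_iff image_iff)
qed simp

lemma centralizer_conj_projs:
  assumes p: "transpose p ** p = mat 1"
  shows "X \<in> centralizer (conj_projs c p) \<longleftrightarrow> transpose p ** X ** p \<in> blocks c"
proof -
  note cancel = matrix_cancel_left[OF p]
  have p': "p ** transpose p = mat 1" using p by (simp add: matrix_left_right_inverse)
  have "(p ** E ** transpose p) ** X = X ** (p ** E ** transpose p) \<longleftrightarrow>
      E ** (transpose p ** X ** p) = (transpose p ** X ** p) ** E" for E
  proof
    assume "(p ** E ** transpose p) ** X = X ** (p ** E ** transpose p)"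
    then have "transpose p ** ((p ** E ** transpose p) ** X) ** p = transpose p ** (X ** (p ** E ** transpose p)) ** p"
      by simp
    then show "E ** (transpose p ** X ** p) = (transpose p ** X ** p) ** E"
      by (simp add: cancel p flip: matrix_mul_assoc)
  next
    assume "E ** (transpose p ** X ** p) = (transpose p ** X ** p) ** E"
    then have "p ** (E ** (transpose p ** X ** p)) ** transpose p = p ** ((transpose p ** X ** p) ** E) ** transpose p"
      by simp
    then show "(p ** E ** transpose p) ** X = X ** (p ** E ** transpose p)"
      by (simp add: cancel p' flip: matrix_mul_assoc)
  qed
  then show ?thesis by (auto simp: centralizer_def conj_projs_def)
qed

text \<open>Orthogonality gives p^T = R^-1 P^T L^-1. As \<open>R\<close> commutes with the block
  projection E, Q equals L (P E P^T) L^-1, whose middle factor is diagonal.\<close>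

lemma conj_projs_in_blocks:
  fixes P :: "real^'n^'n"
  assumes P: "permutation_matrix P" and p: "transpose p ** p = mat 1" "p = L ** P ** R"
    and LR: "L \<in> blocks c" "R \<in> blocks c" and Q: "Q \<in> conj_projs c p"
  shows "Q \<in> blocks c"
proof -
  obtain m where m: "Q = p ** block_proj c m ** transpose p" using Q by (auto simp: conj_projs_def)
  have "invertible p" using p(1) invertible_left_inverse by blast
  then have "invertible L" "invertible R" using invertible_of_mult3 p(2) by metis+
  then obtain L' R' where L': "L ** L' = mat 1" and R': "R ** R' = mat 1"
    unfolding invertible_def by blast
  have L'_blocks: "L' \<in> blocks c" by (rule centralizer_inverse[OF LR(1) L'])
  have p': "p ** transpose p = mat 1" using p(1) by (simp add: matrix_left_right_inverse)
  have "p ** (R' ** transpose P ** L') = mat 1"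
    using permutation_matrix_mult_transpose[OF P] matrix_cancel_left[OF R'] L'
      matrix_cancel_left[OF permutation_matrix_mult_transpose[OF P]]
    by (simp add: p(2) flip: matrix_mul_assoc)
  then have tp: "transpose p = R' ** transpose P ** L'"
    using matrix_cancel_left(2)[OF p', of "R' ** transpose P ** L'"] by simp
  have comm: "R ** block_proj c m = block_proj c m ** R"
    using centralizerD[OF LR(2)] by (metis rangeI)
  have "Q = L ** P ** (R ** block_proj c m) ** (R' ** transpose P ** L')"
    unfolding m tp by (simp add: p(2) matrix_mul_assoc)
  also have "\<dots> = L ** (P ** block_proj c m ** transpose P) ** L'"
    unfolding comm using matrix_cancel_left[OF R'] by (simp flip: matrix_mul_assoc)
  finally show ?thesis
    using centralizer_mult[OF centralizer_mult[OF LR(1) permutation_matrix_conj_block_proj[OF P]] L'_blocks]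
    by simp
qed

text \<open>The base point absorbs \<open>P\<close>: if C p = L P R, then C is the product of L
  L0^-1 and p (R0^-1 R) p^T. Conversely, C = L R gives C p = (L L0) P (R0 p^T R p).\<close>

lemma butterfly_near_iff:
  fixes P :: "real^'n^'n"
  assumes p: "transpose p ** p = mat 1" "p = L0 ** P ** R0" "L0 \<in> blocks c" "R0 \<in> blocks c"
  shows "(\<exists>L\<in>blocks c. \<exists>R\<in>blocks c. C ** p = L ** P ** R) \<longleftrightarrow>
    (\<exists>L\<in>blocks c. \<exists>R\<in>centralizer (conj_projs c p). C = L ** R)"
proof
  have p': "p ** transpose p = mat 1" using p(1) by (simp add: matrix_left_right_inverse)
  have "invertible p" using p(1) invertible_left_inverse by blast
  then have "invertible L0" "invertible R0" using invertible_of_mult3 p(2) by metis+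
  then obtain L' R' where L': "L' ** L0 = mat 1" and R': "R0 ** R' = mat 1"
    unfolding invertible_def by blast
  have L'_blocks: "L' \<in> blocks c"
    using L' by (intro centralizer_inverse[OF p(3)]) (simp add: matrix_left_right_inverse)
  have R'_blocks: "R' \<in> blocks c" by (rule centralizer_inverse[OF p(4) R'])
  {
    assume "\<exists>L\<in>blocks c. \<exists>R\<in>blocks c. C ** p = L ** P ** R"
    then obtain L R where LR: "L \<in> blocks c" "R \<in> blocks c" "C ** p = L ** P ** R" by blast
    have "transpose p ** (p ** (R' ** R) ** transpose p) ** p = R' ** R"
      using matrix_cancel_left[OF p(1)] p(1) by (simp flip: matrix_mul_assoc)
    then have "p ** (R' ** R) ** transpose p \<in> centralizer (conj_projs c p)"
      using centralizer_mult[OF R'_blocks LR(2)] by (simp add: centralizer_conj_projs[OF p(1)])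
    moreover have "C = (L ** L') ** (p ** (R' ** R) ** transpose p)"
    proof -
      have "L' ** (p ** (R' ** R)) = P ** R"
        using matrix_cancel_left[OF L'] matrix_cancel_left[OF R'] by (simp add: p(2) flip: matrix_mul_assoc)
      then have "(L ** L') ** (p ** (R' ** R) ** transpose p) = L ** (P ** R) ** transpose p"
        by (simp add: matrix_mul_assoc) (metis matrix_mul_assoc)
      also have "\<dots> = C ** (p ** transpose p)" using LR(3) by (simp add: matrix_mul_assoc)
      finally show ?thesis using p' by simp
    qed
    ultimately show "\<exists>L\<in>blocks c. \<exists>R\<in>centralizer (conj_projs c p). C = L ** R"
      using centralizer_mult[OF LR(1) L'_blocks] by blast
  }
  {
    assume "\<exists>L\<in>blocks c. \<exists>R\<in>centralizer (conj_projs c p). C = L ** R"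
    then obtain L R where LR: "L \<in> blocks c" "R \<in> centralizer (conj_projs c p)" "C = L ** R" by blast
    have "C ** p = L ** (p ** (transpose p ** R ** p))"
      using matrix_cancel_left[OF p'] by (simp add: LR(3) flip: matrix_mul_assoc)
    also have "\<dots> = (L ** L0) ** P ** (R0 ** (transpose p ** R ** p))"
      by (subst p(2)) (simp add: matrix_mul_assoc)
    finally show "\<exists>L\<in>blocks c. \<exists>R\<in>blocks c. C ** p = L ** P ** R"
      using centralizer_mult[OF LR(1) p(3)] centralizer_mult[OF p(4)] LR(2) centralizer_conj_projs[OF p(1)]
      by blast
  }
qed

section \<open>Constancy of the dimension\<close>

text \<open>The congruence Y -> M Y M^T is injective, preserves skewness and commutes with
  \<open>block_part c\<close>. Exchanging the two points later turns the inequality into an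
  equality.\<close>

lemma dim_model_space_le:
  fixes p :: "real^'n^'n"
  assumes p: "transpose p ** p = mat 1" and q: "transpose q ** q = mat 1" "q = M ** p ** N"
    and MN: "M \<in> blocks c" "N \<in> blocks c"
  shows "dim (model_space c (conj_projs c p)) \<le> dim (model_space c (conj_projs c q))"
proof -
  define f where "f Y = M ** Y ** transpose M" for Y
  have q': "q ** transpose q = mat 1" using q(1) by (simp add: matrix_left_right_inverse)
  have "invertible q" using q(1) invertible_left_inverse by blast
  then have "invertible M" "invertible N" using invertible_of_mult3 q(2) by metis+
  then obtain M' N' where M': "M' ** M = mat 1" and N': "N ** N' = mat 1"
    unfolding invertible_def by blast
  have tM': "transpose M ** transpose M' = mat 1"
    using M' by (metis matrix_transpose_mul transpose_mat)
  have tN': "transpose N' ** transpose N = mat 1"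
    using N' by (metis matrix_transpose_mul transpose_mat)
  have tM: "transpose M \<in> blocks c"
    using MN(1) transpose_block_proj by (intro centralizer_transpose) auto
  have N'_blocks: "N' \<in> blocks c" by (rule centralizer_inverse[OF MN(2) N'])
  then have tN'_blocks: "transpose N' \<in> blocks c"
    using transpose_block_proj by (intro centralizer_transpose) auto
  \<comment> \<open>Orthogonality of \<open>p\<close> and \<open>q\<close> rewrites M^T q as p N^-T,
    which reduces conjugation by \<open>q\<close> to conjugation by \<open>p\<close> up to
    block-diagonal factors.\<close>
  have Mq: "transpose M ** q = p ** transpose N'"
  proof -
    have "transpose N ** (transpose p ** (transpose M ** q)) = mat 1"
      using q by (simp add: matrix_transpose_mul matrix_mul_assoc)
    then have "p ** (transpose N' ** (transpose N ** (transpose p ** (transpose M ** q)))) = p ** transpose N'"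
      by simp
    moreover have "p ** transpose p = mat 1" using p by (simp add: matrix_left_right_inverse)
    ultimately show ?thesis
      using matrix_cancel_left[OF tN'] matrix_cancel_left[OF \<open>p ** transpose p = mat 1\<close>] by simp
  qed
  have qM: "transpose q ** M = N' ** transpose p"
    using arg_cong[OF Mq, of transpose] by (simp add: matrix_transpose_mul)
  have "linear f"
    unfolding f_def by (intro linearI)
      (simp_all add: matrix_mult.add_left matrix_mult.add_right matrix_mult.scaleR_left matrix_mult.scaleR_right)
  moreover have "M' ** f Y ** transpose M' = Y" for Y
    unfolding f_def using matrix_cancel_left[OF M'] tM' by (simp flip: matrix_mul_assoc)
  then have "inj f" by (metis injI)
  ultimately have "dim (f ` model_space c (conj_projs c p)) = dim (model_space c (conj_projs c p))"
    by (intro dim_image_eq) (auto intro: inj_on_subset)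
  moreover have "f ` model_space c (conj_projs c p) \<subseteq> model_space c (conj_projs c q)"
  proof safe
    fix Y assume Y: "Y \<in> model_space c (conj_projs c p)"
    have "transpose (f Y) = M ** transpose Y ** transpose M"
      by (simp add: f_def matrix_transpose_mul matrix_mul_assoc)
    also have "\<dots> = - f Y"
      using Y by (simp add: model_space_def f_def matrix_mult.minus_left matrix_mult.minus_right)
    finally have skew: "transpose (f Y) = - f Y" .
    let ?Z = "Y - block_part c Y"
    have Z: "transpose p ** ?Z ** p \<in> blocks c"
      using Y by (simp add: model_space_def centralizer_conj_projs[OF p])
    have "f Y - block_part c (f Y) = M ** ?Z ** transpose M"
      unfolding f_def block_part_mult_right[OF tM] block_part_mult_left[OF MN(1)]
      by (simp add: matrix_mult.diff_left matrix_mult.diff_right)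
    then have "transpose q ** (f Y - block_part c (f Y)) ** q = (transpose q ** M) ** ?Z ** (transpose M ** q)"
      by (simp only: matrix_mul_assoc)
    also have "\<dots> = N' ** (transpose p ** ?Z ** p) ** transpose N'"
      unfolding Mq qM by (simp only: matrix_mul_assoc)
    finally have "transpose q ** (f Y - block_part c (f Y)) ** q \<in> blocks c"
      using centralizer_mult[OF centralizer_mult[OF N'_blocks Z] tN'_blocks] by simp
    then show "f Y \<in> model_space c (conj_projs c q)"
      using skew by (simp add: model_space_def centralizer_conj_projs[OF q(1)])
  qed
  ultimately show ?thesis by (metis dim_subset)
qed

text \<open>Since O(n) is embedded in the matrix space and GL_n is open there, a submanifold of the
  matrix space inside O(n) is embedded in both. Hence the inclusion is paired with the submanifold
  property in the matrix space.\<close>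

theorem theorem3:
  fixes idx :: "'n::finite \<Rightarrow> nat" and b :: nat and PL P PR :: "real^'n^'n"
  assumes "bij_betw idx (UNIV :: 'n set) {0..<CARD('n)}"
    and "b > 0" and "b dvd CARD('n)"
    and "permutation_matrix PL" and "permutation_matrix P" and "permutation_matrix PR"
  shows "GS idx b PL P PR \<subseteq> {A. orthogonal_matrix A}
    \<and> (\<exists>k. smooth_embedded_submanifold (GS idx b PL P PR) k)"
proof
  show "GS idx b PL P PR \<subseteq> {A. orthogonal_matrix A}" by (auto simp: GS_def)
  define c where "c i = idx i div b" for i
  define G where "G = GS idx b PL P PR"
  \<comment> \<open>This strips the outer permutations; \<open>u p\<close> is the p' of the opening
    sketch.\<close>
  define u where "u X = transpose PL ** X ** transpose PR" for X
  define K where "K p = conj_projs c (u p)" for p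
  have blocks: "block_diagonal idx b X \<longleftrightarrow> X \<in> blocks c" for X
    by (simp add: block_diagonal_def in_blocks_iff c_def)
  note PL = permutation_matrix_mult_transpose[OF assms(4)]
  note PR = permutation_matrix_mult_transpose[OF assms(6)]
  have PL': "transpose PL ** PL = mat 1" and PR': "transpose PR ** PR = mat 1"
    using PL PR by (simp_all add: matrix_left_right_inverse)
  note cancel = matrix_cancel_left[OF PL] matrix_cancel_left[OF PR]
  have G_iff: "X \<in> G \<longleftrightarrow> transpose (u X) ** u X = mat 1 \<and>
      (\<exists>L\<in>blocks c. \<exists>R\<in>blocks c. u X = L ** P ** R)" for X
  proof -
    have "X = PL ** L ** P ** R ** PR \<longleftrightarrow> u X = L ** P ** R" for L R
    proof
      assume "X = PL ** L ** P ** R ** PR"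
      then show "u X = L ** P ** R" by (simp add: u_def cancel PR flip: matrix_mul_assoc)
    next
      assume "u X = L ** P ** R"
      then have "PL ** (u X) ** PR = PL ** L ** P ** R ** PR" by (simp add: matrix_mul_assoc)
      then show "X = PL ** L ** P ** R ** PR" by (simp add: u_def cancel PR' flip: matrix_mul_assoc)
    qed
    moreover have "transpose (u X) ** u X = mat 1 \<longleftrightarrow> transpose X ** X = mat 1"
    proof -
      have eq: "transpose (u X) ** u X = PR ** (transpose X ** X) ** transpose PR"
        by (simp add: u_def matrix_transpose_mul cancel flip: matrix_mul_assoc)
      have "transpose X ** X = transpose PR ** (transpose (u X) ** u X) ** PR"
        unfolding eq by (simp add: cancel PR' flip: matrix_mul_assoc)
      with eq show ?thesis by (metis PR PR' matrix_mul_rid)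
    qed
    ultimately show ?thesis
      by (simp add: G_def GS_def orthogonal_matrix_def blocks matrix_left_right_inverse) blast
  qed
  have u_orth: "transpose (u p) ** u p = mat 1" if "p \<in> G" for p using that G_iff by blast
  \<comment> \<open>The 0 is a placeholder, as the empty set is a submanifold for any
    \<open>k\<close>. Otherwise the dimension is read off at one chosen point.\<close>
  define k where "k = (if G = {} then 0 else dim (model_space c (K (SOME p. p \<in> G))))"
  have dim_le: "dim (model_space c (K p)) \<le> dim (model_space c (K q))" if pq: "p \<in> G" "q \<in> G" for p q
  proof -
    obtain L R where p: "L \<in> blocks c" "R \<in> blocks c" "u p = L ** P ** R" using pq(1) G_iff by blast
    obtain L1 R1 where q: "L1 \<in> blocks c" "R1 \<in> blocks c" "u q = L1 ** P ** R1" using pq(2) G_iff by blast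
    have "invertible (u p)" using u_orth[OF pq(1)] invertible_left_inverse by blast
    then have "invertible L" "invertible R" using invertible_of_mult3 p(3) by metis+
    then obtain L' R' where L': "L ** L' = mat 1" and R': "R ** R' = mat 1"
      unfolding invertible_def by blast
    \<comment> \<open>Solving for \<open>P\<close> at \<open>p\<close> shows that any two points of
      the set differ by block-diagonal factors on the two sides.\<close>
    have "u q = (L1 ** L') ** u p ** (R' ** R1)"
      using matrix_cancel_left[OF L'] matrix_cancel_left[OF R'] by (simp add: p(3) q(3) flip: matrix_mul_assoc)
    then show ?thesis
      unfolding K_def
      using centralizer_mult[OF q(1) centralizer_inverse[OF p(1) L']]
        centralizer_mult[OF centralizer_inverse[OF p(2) R'] q(2)]
      by (intro dim_model_space_le u_orth pq)
  qed
  have dim: "dim (model_space c (K p)) = k" if "p \<in> G" for p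
    using that dim_le someI[of "\<lambda>p. p \<in> G"] by (auto simp: k_def intro: antisym)
  have "smooth_embedded_submanifold G k"
  proof (rule smooth_embedded_submanifoldI)
    fix p assume p: "p \<in> G"
    \<comment> \<open>\<open>T X\<close> is the C of the opening sketch. It moves \<open>p\<close>
      to the identity, where the chart is known to be regular.\<close>
    define T where "T X = u X ** transpose (u p)" for X
    note orth = u_orth[OF p]
    have up: "u p ** transpose (u p) = mat 1" using orth by (simp add: matrix_left_right_inverse)
    obtain L R where LR: "L \<in> blocks c" "R \<in> blocks c" "u p = L ** P ** R" using p G_iff by blast
    have T_p: "T p = mat 1" by (simp add: T_def up)
    have u_T: "u X = T X ** u p" for X by (simp add: T_def orth flip: matrix_mul_assoc)
    have bl: "bounded_linear T"
      unfolding T_def u_def linear_conv_bounded_linear[symmetric]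
      by (intro linearI) (simp_all add: matrix_mult.add_left matrix_mult.add_right
          matrix_mult.scaleR_left matrix_mult.scaleR_right)
    have "PL ** (T X ** u p) ** PR = X" for X
      unfolding u_T[symmetric] by (simp add: u_def cancel PR' flip: matrix_mul_assoc)
    then have "inj T" by (metis injI)
    have T_orth: "transpose (u X) ** u X = mat 1 \<longleftrightarrow> transpose (T X) ** T X = mat 1" for X
    proof -
      have eq: "transpose (T X) ** T X = u p ** (transpose (u X) ** u X) ** transpose (u p)"
        by (simp add: T_def matrix_transpose_mul flip: matrix_mul_assoc)
      have "transpose (u X) ** u X = transpose (u p) ** (transpose (T X) ** T X) ** u p"
        unfolding eq by (simp add: matrix_cancel_left[OF up] orth flip: matrix_mul_assoc)
      with eq show ?thesis by (metis up orth matrix_mul_rid)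
    qed
    have "finite (K p)"
      using finite_range_block_proj[of c] unfolding K_def conj_projs_def
      by (subst image_image[symmetric, where g = "block_proj c" and f = "\<lambda>E. u p ** E ** transpose (u p)"]) simp
    moreover have "transpose Q = Q" "Q ** Q = Q" "Q \<in> blocks c" if "Q \<in> K p" for Q
    proof -
      obtain m where m: "Q = u p ** block_proj c m ** transpose (u p)"
        using \<open>Q \<in> K p\<close> by (auto simp: K_def conj_projs_def)
      show "transpose Q = Q"
        by (simp add: m matrix_transpose_mul transpose_block_proj matrix_mul_assoc)
      have "block_proj c m ** (block_proj c m ** transpose (u p)) = block_proj c m ** transpose (u p)"
        by (simp add: matrix_mul_assoc block_proj_idem)
      then show "Q ** Q = Q"
        by (simp add: m matrix_cancel_left[OF up] flip: matrix_mul_assoc)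
      show "Q \<in> blocks c"
        using that unfolding K_def by (rule conj_projs_in_blocks[OF assms(5) orth LR(3,1,2)])
    qed
    ultimately have "\<forall>\<^sub>F C in nhds (mat 1). chart c C \<in> model_space c (K p) \<longleftrightarrow>
        transpose C ** C = mat 1 \<and> (\<exists>L\<in>blocks c. \<exists>R\<in>centralizer (K p). C = L ** R)"
      by (rule eventually_chart_iff)
    moreover have "filterlim T (nhds (mat 1)) (nhds p)"
      using bounded_linear.tendsto[OF bl filterlim_ident[of "nhds p"]] by (simp add: T_p)
    ultimately have "\<forall>\<^sub>F X in nhds p. chart c (T X) \<in> model_space c (K p) \<longleftrightarrow>
        transpose (T X) ** T X = mat 1 \<and> (\<exists>L\<in>blocks c. \<exists>R\<in>centralizer (K p). T X = L ** R)"
      by (rule eventually_compose_filterlim)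
    \<comment> \<open>Since \<open>u X\<close> is \<open>T X ** u p\<close>, factoring
      \<open>T X\<close> through the two algebras amounts to factoring \<open>u X\<close> through
      \<open>P\<close>.\<close>
    then have ev: "\<forall>\<^sub>F X in nhds p. X \<in> G \<longleftrightarrow> chart c (T X) \<in> model_space c (K p)"
      by (rule eventually_mono)
        (simp add: G_iff T_orth butterfly_near_iff[OF orth LR(3,1,2)] u_T[symmetric] K_def
          flip: butterfly_near_iff[OF orth LR(3,1,2)])
    have "((\<lambda>X. chart c (T X)) has_derivative (\<lambda>h. 2 *\<^sub>R T h)) (at p)"
      using has_derivative_compose[OF bounded_linear_imp_has_derivative[OF bl], of "chart c" _ p]
        has_derivative_chart[of c] by (simp add: T_p)
    moreover have "inj (\<lambda>h. 2 *\<^sub>R T h)"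
      using \<open>inj T\<close> by (auto simp: inj_def)
    ultimately show "\<exists>(f :: real^'n^'n \<Rightarrow> real^'n^'n) f' W. smooth_on UNIV f \<and> (f has_derivative f') (at p) \<and> inj f'
        \<and> subspace W \<and> dim W = k \<and> (\<forall>\<^sub>F x in nhds p. x \<in> G \<longleftrightarrow> f x \<in> W)"
      using smooth_chart[OF bl, of c] subspace_model_space[of c "K p"] dim[OF p] ev
      by (intro exI[of _ "\<lambda>X. chart c (T X)"] exI[of _ "\<lambda>h. 2 *\<^sub>R T h"] exI[of _ "model_space c (K p)"] conjI)
  qed
  then show "\<exists>k. smooth_embedded_submanifold (GS idx b PL P PR) k"
    unfolding G_def by blast
qed

end
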